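(* For any nonbipartite triangle free $C_5$-connected graphs $G$ and $H$ of diameter two, $$\dim_s(G\times H)=\beta(G\Box H).$$
   Context: All graphs are finite and simple; $d_G(x,y)$ is the number of edges of a shortest $x$–$y$ path, and the diameter of $G$ is the maximum of $d_G(u,v)$ over all vertices $u,v$. A graph is $C_5$-connected if every pair of its vertices lies on a common five-cycle. In a connected graph $G$, a vertex $w$ strongly resolves two different vertices $u,v$ if $d_G(w,u)=d_G(w,v)+d_G(v,u)$ or $d_G(w,v)=d_G(w,u)+d_G(u,v)$. A set $S$ of vertices is a strong metric generator if every two different vertices are strongly resolved by some vertex of $S$; the strong metric dimension $\dim_s(G)$ is the smallest cardinality of a strong metric generator. The vertex cover number $\beta(G)$ is the smallest cardinality of a set of vertices incident with every edge of $G$. Products have vertex set $V(G)\times V(H)$. Direct product $G\times H$: $(g,h)\sim(g',h')$ iff $gg'\in E(G)$ and $hh'\in E(H)$. Cartesian product $G\Box H$: $(g,h)\sim(g',h')$ iff ($g=g'$ and $hh'\in E(H)$) or ($h=h'$ and $gg'\in E(G)$). *)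

theory Defs
  imports "Graph_Theory.Graph_Theory"
begin

text \<open>
  A finite simple graph is a \<^locale>\<open>pair_graph\<close>: a finite symmetric loop-free digraph without
  parallel arcs, each undirected edge being represented by its two orientations.
\<close>

text \<open>
  With unit weights the cost of a walk is its number of edges. The value is \<open>\<infinity>\<close> iff there is no
  walk, which is why distances live in \<^typ>\<open>ereal\<close>.
\<close>
definition gdist :: "'a pair_pre_digraph \<Rightarrow> 'a \<Rightarrow> 'a \<Rightarrow> ereal" where
  "gdist G u v = wf_digraph.\<mu> (with_proj G) (\<lambda>_. 1) u v"

definition diam :: "'a pair_pre_digraph \<Rightarrow> ereal" where
  "diam G = Max {gdist G u v | u v. u \<in> pverts G \<and> v \<in> pverts G}"

definition bipartite :: "'a pair_pre_digraph \<Rightarrow> bool" where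
  "bipartite G \<longleftrightarrow>
     (\<exists>U W. U \<union> W = pverts G \<and> U \<inter> W = {} \<and> parcs G \<subseteq> U \<times> W \<union> W \<times> U)"

text \<open>
  The predicate \<^const>\<open>pre_digraph.cycle\<close> also accepts the closed walk \<open>a, b, a\<close>, but from length
  three on it describes exactly the cycles of an undirected graph.
\<close>
definition triangle_free :: "'a pair_pre_digraph \<Rightarrow> bool" where
  "triangle_free G \<longleftrightarrow> \<not> (\<exists>p. pre_digraph.cycle (with_proj G) p \<and> length p = 3)"

text \<open>The vertices of a cycle, given as a list of arcs, are the tails of its arcs.\<close>
definition C5_connected :: "'a pair_pre_digraph \<Rightarrow> bool" where
  "C5_connected G \<longleftrightarrow>
     (\<forall>u \<in> pverts G. \<forall>v \<in> pverts G. u \<noteq> v \<longrightarrow>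
        (\<exists>p. pre_digraph.cycle (with_proj G) p \<and> length p = 5 \<and>
             u \<in> fst ` set p \<and> v \<in> fst ` set p))"

definition strongly_resolves :: "'a pair_pre_digraph \<Rightarrow> 'a \<Rightarrow> 'a \<Rightarrow> 'a \<Rightarrow> bool" where
  "strongly_resolves G w u v \<longleftrightarrow>
     gdist G w u = gdist G w v + gdist G v u \<or> gdist G w v = gdist G w u + gdist G u v"

definition strong_metric_generator :: "'a pair_pre_digraph \<Rightarrow> 'a set \<Rightarrow> bool" where
  "strong_metric_generator G S \<longleftrightarrow>
     S \<subseteq> pverts G \<and>
     (\<forall>u \<in> pverts G. \<forall>v \<in> pverts G. u \<noteq> v \<longrightarrow> (\<exists>w \<in> S. strongly_resolves G w u v))"

text \<open>Meaningful for finite connected graphs only, since otherwise infinite distances occur.\<close>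
definition strong_metric_dim :: "'a pair_pre_digraph \<Rightarrow> nat" where
  "strong_metric_dim G = (LEAST n. \<exists>S. strong_metric_generator G S \<and> card S = n)"

definition vertex_cover :: "'a pair_pre_digraph \<Rightarrow> 'a set \<Rightarrow> bool" where
  "vertex_cover G S \<longleftrightarrow> S \<subseteq> pverts G \<and> (\<forall>(u, v) \<in> parcs G. u \<in> S \<or> v \<in> S)"

definition vertex_cover_number :: "'a pair_pre_digraph \<Rightarrow> nat" where
  "vertex_cover_number G = (LEAST n. \<exists>S. vertex_cover G S \<and> card S = n)"

definition direct_product ::
    "'a pair_pre_digraph \<Rightarrow> 'b pair_pre_digraph \<Rightarrow> ('a \<times> 'b) pair_pre_digraph" where
  "direct_product G H =
     \<lparr> pverts = pverts G \<times> pverts H,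
       parcs = {((g, h), (g', h')) | g h g' h'. (g, g') \<in> parcs G \<and> (h, h') \<in> parcs H} \<rparr>"

definition cartesian_product ::
    "'a pair_pre_digraph \<Rightarrow> 'b pair_pre_digraph \<Rightarrow> ('a \<times> 'b) pair_pre_digraph" where
  "cartesian_product G H =
     \<lparr> pverts = pverts G \<times> pverts H,
       parcs = {((g, h), (g', h')) | g h g' h'.
                  g \<in> pverts G \<and> g' \<in> pverts G \<and> h \<in> pverts H \<and> h' \<in> pverts H \<and>
                  (g = g' \<and> (h, h') \<in> parcs H \<or> h = h' \<and> (g, g') \<in> parcs G)} \<rparr>"

lemma pair_graph_direct_product:
  assumes "pair_graph G" "pair_graph H"
  shows "pair_graph (direct_product G H)"
proof -
  interpret G: pair_graph G by fact
  interpret H: pair_graph H by fact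
  let ?P = "direct_product G H"
  have sub: "parcs ?P \<subseteq> pverts ?P \<times> pverts ?P"
    using G.arc_fst_in_verts G.arc_snd_in_verts H.arc_fst_in_verts H.arc_snd_in_verts
    by (fastforce simp: direct_product_def)
  have fin: "finite (pverts ?P)"
    by (simp add: direct_product_def G.pair_finite_verts H.pair_finite_verts)
  have sym: "sym (parcs ?P)"
    using G.pair_sym_arcs H.pair_sym_arcs
    by (auto simp: direct_product_def symmetric_def sym_def)
  have loopfree: "fst e \<noteq> snd e" if "e \<in> parcs ?P" for e
    using that by (auto simp: direct_product_def dest: G.no_loops')
  show ?thesis
  proof unfold_locales
    show "finite (parcs ?P)"
      using sub fin by (meson finite_SigmaI finite_subset)
  qed (use sub fin sym loopfree in \<open>auto simp: symmetric_def\<close>)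
qed

lemma pair_graph_cartesian_product:
  assumes "pair_graph G" "pair_graph H"
  shows "pair_graph (cartesian_product G H)"
proof -
  interpret G: pair_graph G by fact
  interpret H: pair_graph H by fact
  let ?P = "cartesian_product G H"
  have sub: "parcs ?P \<subseteq> pverts ?P \<times> pverts ?P"
    by (auto simp: cartesian_product_def)
  have fin: "finite (pverts ?P)"
    by (simp add: cartesian_product_def G.pair_finite_verts H.pair_finite_verts)
  have sym: "sym (parcs ?P)"
    using G.pair_sym_arcs H.pair_sym_arcs
    by (auto simp: cartesian_product_def symmetric_def sym_def)
  have loopfree: "fst e \<noteq> snd e" if "e \<in> parcs ?P" for e
    using that by (auto simp: cartesian_product_def dest: G.no_loops' H.no_loops')
  show ?thesis
  proof unfold_locales
    show "finite (parcs ?P)"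
      using sub fin by (meson finite_SigmaI finite_subset)
  qed (use sub fin sym loopfree in \<open>auto simp: symmetric_def\<close>)
qed

lemma gdist_eq_INF:
  assumes "pair_graph G"
  shows "gdist G u v =
    (INF p \<in> {p. pre_digraph.awalk (with_proj G) u p v}. ereal (real (length p)))"
proof -
  interpret pair_graph G by fact
  have "awalk_cost (\<lambda>_. 1) p = real (length p)" for p
    by (induction p) simp_all
  then show ?thesis
    by (simp add: gdist_def \<mu>_def)
qed

end

theory Submission
  imports Defs
begin

text \<open>
  In a triangle-free \<open>C\<^sub>5\<close>-connected graph with at least one edge, the numbers \<open>n \<le> 4\<close> for which
  two vertices are joined by a walk of length \<open>n\<close> depend only on whether the vertices are equal
  (\<open>0, 2, 4\<close>), adjacent (\<open>1, 3, 4\<close>) or neither (\<open>2, 3, 4\<close>). A walk in \<open>G \<times> H\<close> is a pair of walks of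
  the same length in \<open>G\<close> and \<open>H\<close>, so the distance of two vertices of \<open>G \<times> H\<close> is the smallest length
  that is available in both coordinates (\<open>gdist_direct_product\<close>). This distance is at most \<open>4\<close>, and
  it is \<open>4\<close> exactly when one coordinate is equal and the other adjacent, that is, on the edges of
  \<open>G \<box> H\<close>.

  Hence the strong metric generators of \<open>G \<times> H\<close> are exactly the vertex covers of \<open>G \<box> H\<close>. For an
  edge \<open>uv\<close> of \<open>G \<box> H\<close>, a vertex \<open>w\<close> that strongly resolves \<open>u\<close> and \<open>v\<close> satisfies
  \<open>d(w, u) = d(w, v) + 4\<close> or \<open>d(w, v) = d(w, u) + 4\<close>; as no distance exceeds \<open>4\<close>, it is \<open>u\<close> or \<open>v\<close>.
  Conversely, every shortest path from \<open>u\<close> to another vertex \<open>v\<close> extends beyond \<open>v\<close> to a shortest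
  path of length \<open>4\<close>, ending in some \<open>w\<close> (\<open>geodesic_extends\<close>). Then \<open>u\<close> and \<open>w\<close> both strongly
  resolve \<open>u\<close> and \<open>v\<close>, and a vertex cover contains one of them because \<open>uw\<close> is an edge of \<open>G \<box> H\<close>.
\<close>

section \<open>Walks as powers of the arc relation\<close>

context pair_graph
begin

lemma awalk_imp_relpow:
  assumes "awalk u p v"
  shows "(u, v) \<in> parcs G ^^ length p"
  using assms
proof (induction p arbitrary: u)
  case Nil
  then show ?case by (simp add: awalk_def)
next
  case (Cons e p)
  then have "e \<in> parcs G" "fst e = u" "awalk (snd e) p v"
    by (auto simp: awalk_Cons_iff)
  with Cons.IH[of "snd e"] show ?case
    by (metis length_Cons prod.collapse relpow_Suc_I2)
qed

lemma relpow_imp_awalk: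
  assumes "u \<in> pverts G" "(u, v) \<in> parcs G ^^ n"
  shows "\<exists>p. awalk u p v \<and> length p = n"
  using assms
proof (induction n arbitrary: u)
  case 0
  then show ?case by (auto simp: awalk_def)
next
  case (Suc n)
  then obtain x where x: "(u, x) \<in> parcs G" "(x, v) \<in> parcs G ^^ n"
    by (meson relpow_Suc_E2)
  then obtain p where "awalk x p v" "length p = n"
    using Suc.IH wellformed' by blast
  with x show ?case
    by (intro exI[of _ "(u, x) # p"]) (auto simp: awalk_Cons_iff)
qed

text \<open>
  Arc lists of different graphs cannot be compared directly, whereas powers of the arc relation of
  a direct product split into powers in the two factors. Hence distances are computed from powers.
\<close>
lemma gdist_eqI:
  assumes "u \<in> pverts G" "(u, v) \<in> parcs G ^^ n"
    and "\<And>m. m < n \<Longrightarrow> (u, v) \<notin> parcs G ^^ m"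
  shows "gdist G u v = ereal (real n)"
proof -
  obtain p where p: "awalk u p v" "length p = n"
    using relpow_imp_awalk[OF assms(1,2)] by blast
  have "n \<le> length q" if "awalk u q v" for q
    using assms(3) awalk_imp_relpow[OF that] by (meson not_less)
  then have "(INF q \<in> {q. awalk u q v}. ereal (real (length q))) = ereal (real n)"
    by (intro antisym INF_greatest INF_lower2[of p]) (auto simp: p)
  then show ?thesis
    by (simp add: gdist_eq_INF[OF pair_graph_axioms])
qed

section \<open>Triangles and five-cycles\<close>

lemma triangle_freeD:
  assumes "triangle_free G" "(x, y) \<in> parcs G" "(y, z) \<in> parcs G"
  shows "(z, x) \<notin> parcs G"
proof
  assume zx: "(z, x) \<in> parcs G"
  have "x \<noteq> y" "y \<noteq> z" "z \<noteq> x"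
    using assms zx no_loops' by blast+
  then have "cycle [(x, y), (y, z), (z, x)]"
    using assms zx wellformed'
    by (auto simp: cycle_def awalk_Cons_iff awalk_Nil_iff)
  with assms(1) show False
    by (force simp: triangle_free_def)
qed

text \<open>
  Two different vertices of a five-cycle are either consecutive on it, or they split it into paths
  of lengths two and three.
\<close>
lemma C5_connectedD:
  assumes "C5_connected G" "u \<in> pverts G" "v \<in> pverts G" "u \<noteq> v"
  obtains
    (consecutive) x y z where "(u, v) \<in> parcs G" "(v, x) \<in> parcs G" "(x, y) \<in> parcs G"
      "(y, z) \<in> parcs G" "(z, u) \<in> parcs G"
  | (opposite) x y z where "(u, x) \<in> parcs G" "(x, v) \<in> parcs G" "(v, y) \<in> parcs G"
      "(y, z) \<in> parcs G" "(z, u) \<in> parcs G"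
proof -
  obtain p where p: "cycle p" "length p = 5" "u \<in> fst ` set p" "v \<in> fst ` set p"
    using assms unfolding C5_connected_def by blast
  obtain e0 e1 e2 e3 e4 where pe: "p = [e0, e1, e2, e3, e4]"
    using p(2) by (auto simp: numeral_eq_Suc length_Suc_conv)
  obtain a b c d e where
    cyc: "p = [(a, b), (b, c), (c, d), (d, e), (e, a)]"
      and arcs: "(a, b) \<in> parcs G" "(b, c) \<in> parcs G" "(c, d) \<in> parcs G"
        "(d, e) \<in> parcs G" "(e, a) \<in> parcs G"
    using p(1) unfolding pe
    by (cases e0; cases e1; cases e2; cases e3; cases e4)
      (auto simp: cycle_def awalk_Cons_iff awalk_Nil_iff)
  have rev: "(y, x) \<in> parcs G" if "(x, y) \<in> parcs G" for x y
    using that by (rule arcs_symmetric)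
  have "u \<in> {a, b, c, d, e}" "v \<in> {a, b, c, d, e}"
    using p(3,4) by (auto simp: cyc)
  then have "(\<exists>x y z. (u, v) \<in> parcs G \<and> (v, x) \<in> parcs G \<and> (x, y) \<in> parcs G \<and>
        (y, z) \<in> parcs G \<and> (z, u) \<in> parcs G) \<or>
      (\<exists>x y z. (u, x) \<in> parcs G \<and> (x, v) \<in> parcs G \<and> (v, y) \<in> parcs G \<and>
        (y, z) \<in> parcs G \<and> (z, u) \<in> parcs G)"
    using \<open>u \<noteq> v\<close> arcs arcs[THEN rev] by (elim insertE emptyE; hypsubst; blast)
  then show thesis
    using consecutive opposite by blast
qed

end

text \<open>
  A single vertex is vacuously \<open>C\<^sub>5\<close>-connected but carries no closed walk of positive length. The
  last assumption excludes it; nonbipartite graphs satisfy it.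
\<close>
locale C5_graph = pair_graph G for G :: "'a pair_pre_digraph" +
  assumes triangle_free: "triangle_free G"
    and C5_connected: "C5_connected G"
    and has_arc: "parcs G \<noteq> {}"
begin

lemma no_loop: "(u, u) \<notin> parcs G"
  using no_loops' by blast

lemma arc_sym: "(u, v) \<in> parcs G \<Longrightarrow> (v, u) \<in> parcs G"
  by (rule arcs_symmetric)

lemma arc_commute: "(u, v) \<in> parcs G \<longleftrightarrow> (v, u) \<in> parcs G"
  using arc_sym by blast

lemma no_triangle: "(x, y) \<in> parcs G \<Longrightarrow> (y, z) \<in> parcs G \<Longrightarrow> (x, z) \<notin> parcs G"
  using triangle_freeD[OF triangle_free] arc_sym by blast

lemma arc_on_C5:
  assumes "(u, v) \<in> parcs G"
  obtains x y z where "(v, x) \<in> parcs G" "(x, y) \<in> parcs G" "(y, z) \<in> parcs G" "(z, u) \<in> parcs G"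
proof -
  have "u \<in> pverts G" "v \<in> pverts G" "u \<noteq> v"
    using assms wellformed' no_loops' by blast+
  then show thesis
    using C5_connectedD[OF C5_connected] that no_triangle assms by metis
qed

lemma nonadjacent_on_C5:
  assumes "u \<in> pverts G" "v \<in> pverts G" "u \<noteq> v" "(u, v) \<notin> parcs G"
  obtains x y z where "(u, x) \<in> parcs G" "(x, v) \<in> parcs G"
    "(v, y) \<in> parcs G" "(y, z) \<in> parcs G" "(z, u) \<in> parcs G"
  using C5_connectedD[OF C5_connected assms(1-3)] that assms(4) by metis

lemma has_neighbour:
  assumes "u \<in> pverts G"
  obtains v where "(u, v) \<in> parcs G"
proof -
  obtain a b where ab: "(a, b) \<in> parcs G"
    using has_arc by auto
  then have "a \<in> pverts G"
    using wellformed' by blast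
  then show thesis
    using that ab arc_on_C5 nonadjacent_on_C5[OF assms, of a] by metis
qed

section \<open>Short walks\<close>

lemma relpow_2_iff: "(u, v) \<in> parcs G ^^ 2 \<longleftrightarrow> (\<exists>x. (u, x) \<in> parcs G \<and> (x, v) \<in> parcs G)"
  by (auto simp: numeral_eq_Suc)

lemma walk_2_iff:
  assumes "u \<in> pverts G" "v \<in> pverts G"
  shows "(u, v) \<in> parcs G ^^ 2 \<longleftrightarrow> (u, v) \<notin> parcs G"
proof (cases "u = v")
  case True
  then show ?thesis
    using has_neighbour[OF assms(1)] arc_sym no_loops' unfolding relpow_2_iff by metis
next
  case False
  then show ?thesis
    using nonadjacent_on_C5[OF assms] no_triangle unfolding relpow_2_iff by metis
qed

text \<open>
  The odd closed walk excluded here would be a triangle; in all other cases one goes back and forth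
  on an edge or takes the long side of a five-cycle.
\<close>
lemma walk_3_iff:
  assumes "u \<in> pverts G" "v \<in> pverts G"
  shows "(u, v) \<in> parcs G ^^ 3 \<longleftrightarrow> u \<noteq> v"
proof -
  have iff: "(u, v) \<in> parcs G ^^ 3 \<longleftrightarrow>
      (\<exists>x y. (u, x) \<in> parcs G \<and> (x, y) \<in> parcs G \<and> (y, v) \<in> parcs G)"
    by (auto simp: numeral_eq_Suc)
  show ?thesis
  proof
    assume "(u, v) \<in> parcs G ^^ 3"
    then show "u \<noteq> v"
      unfolding iff using no_triangle arc_sym by blast
  next
    assume "u \<noteq> v"
    then show "(u, v) \<in> parcs G ^^ 3"
      unfolding iff using nonadjacent_on_C5[OF assms] arc_sym by metis
  qed
qed

text \<open>
  Adjacent vertices are joined by the long side of a five-cycle, all others by a walk of length two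
  followed by a step forth and back.
\<close>
lemma walk_4:
  assumes "u \<in> pverts G" "v \<in> pverts G"
  shows "(u, v) \<in> parcs G ^^ 4"
proof -
  have iff: "(u, v) \<in> parcs G ^^ 4 \<longleftrightarrow>
      (\<exists>x y z. (u, x) \<in> parcs G \<and> (x, y) \<in> parcs G \<and> (y, z) \<in> parcs G \<and> (z, v) \<in> parcs G)"
    by (auto simp: numeral_eq_Suc)
  show ?thesis
  proof (cases "(u, v) \<in> parcs G")
    case True
    then show ?thesis
      unfolding iff using arc_on_C5 arc_sym by metis
  next
    case False
    then obtain x where "(u, x) \<in> parcs G" "(x, v) \<in> parcs G"
      using walk_2_iff[OF assms] relpow_2_iff by blast
    then show ?thesis
      unfolding iff using arc_sym by blast
  qed
qed

section \<open>Moving to a neighbour\<close>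

lemma common_neighbour:
  assumes "u \<in> pverts G" "v \<in> pverts G" "(u, v) \<notin> parcs G"
  obtains w where "(u, w) \<in> parcs G" "(w, v) \<in> parcs G"
  using walk_2_iff assms relpow_2_iff by metis

text \<open>
  On a five-cycle through \<open>u\<close> and \<open>v\<close>, one of the two neighbours of \<open>u\<close> is neither \<open>v\<close> nor next to
  \<open>v\<close>. A chord from it to \<open>v\<close> would create a triangle.
\<close>
lemma neighbour_at_distance_2:
  assumes "u \<in> pverts G" "v \<in> pverts G" "u \<noteq> v"
  obtains w where "(u, w) \<in> parcs G" "w \<noteq> v" "(v, w) \<notin> parcs G"
proof (cases "(u, v) \<in> parcs G")
  case True
  then obtain x y z where "(v, x) \<in> parcs G" "(x, y) \<in> parcs G" "(y, z) \<in> parcs G"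
      "(z, u) \<in> parcs G"
    by (rule arc_on_C5)
  then show thesis
    using that[of z] no_triangle True arc_sym by metis
next
  case False
  with assms obtain x y z where "(u, x) \<in> parcs G" "(x, v) \<in> parcs G"
      "(v, y) \<in> parcs G" "(y, z) \<in> parcs G" "(z, u) \<in> parcs G"
    by (metis nonadjacent_on_C5)
  then show thesis
    using that[of z] no_triangle False arc_sym by metis
qed

end

section \<open>Distances in the direct product\<close>

lemma arc_direct_product_iff:
  "((g, h), (g', h')) \<in> parcs (direct_product G H) \<longleftrightarrow> (g, g') \<in> parcs G \<and> (h, h') \<in> parcs H"
  by (simp add: direct_product_def)

lemma relpow_direct_product_iff:
  "((g, h), (g', h')) \<in> parcs (direct_product G H) ^^ n \<longleftrightarrow>
    (g, g') \<in> parcs G ^^ n \<and> (h, h') \<in> parcs H ^^ n"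
proof (induction n arbitrary: g' h')
  case 0
  then show ?case by auto
next
  case (Suc n)
  then show ?case
    by (auto simp: relcomp_unfold arc_direct_product_iff)
qed

locale C5_graph_pair = G: C5_graph G + H: C5_graph H
  for G :: "'a pair_pre_digraph" and H :: "'b pair_pre_digraph"
begin

abbreviation "P \<equiv> direct_product G H"
abbreviation "C \<equiv> cartesian_product G H"

sublocale P: pair_graph P
  using G.pair_graph_axioms H.pair_graph_axioms by (rule pair_graph_direct_product)

lemma pverts_C: "pverts C = pverts P"
  by (simp add: direct_product_def cartesian_product_def)

lemma pverts_P: "pverts P = pverts G \<times> pverts H"
  by (simp add: direct_product_def)

text \<open>
  Each value is the least common element of two of the sets \<open>{0, 2, 4}\<close> (equal), \<open>{1, 3, 4}\<close>
  (adjacent) and \<open>{2, 3, 4}\<close> (neither). The value \<open>4\<close> arises only from the first two.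
\<close>
lemma gdist_direct_product:
  assumes "g \<in> pverts G" "g' \<in> pverts G" "h \<in> pverts H" "h' \<in> pverts H"
  shows "gdist P (g, h) (g', h') =
    (if g = g' \<and> h = h' then 0
     else if (g, g') \<in> parcs G \<and> (h, h') \<in> parcs H then 1
     else if g = g' \<and> (h, h') \<in> parcs H \<or> h = h' \<and> (g, g') \<in> parcs G then 4
     else if (g, g') \<in> parcs G \<or> (h, h') \<in> parcs H then 3
     else 2)" (is "_ = ?d")
proof -
  note walks = arc_direct_product_iff relpow_direct_product_iff
    G.walk_2_iff[OF assms(1,2)] G.walk_3_iff[OF assms(1,2)] G.walk_4[OF assms(1,2)]
    H.walk_2_iff[OF assms(3,4)] H.walk_3_iff[OF assms(3,4)] H.walk_4[OF assms(3,4)]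
  define n :: nat where "n =
    (if g = g' \<and> h = h' then 0
     else if (g, g') \<in> parcs G \<and> (h, h') \<in> parcs H then 1
     else if g = g' \<and> (h, h') \<in> parcs H \<or> h = h' \<and> (g, g') \<in> parcs G then 4
     else if (g, g') \<in> parcs G \<or> (h, h') \<in> parcs H then 3
     else 2)"
  have "((g, h), (g', h')) \<in> parcs P ^^ n"
    by (auto simp: n_def walks G.no_loop H.no_loop)
  moreover have "((g, h), (g', h')) \<notin> parcs P ^^ m" if "m < n" for m
  proof -
    from that have "m = 0 \<or> m = 1 \<or> m = 2 \<or> m = 3" "m < n"
      by (auto simp: n_def split: if_splits)
    then show ?thesis
      by (elim disjE) (auto simp: n_def walks G.no_loop H.no_loop split: if_splits)
  qed
  ultimately have "gdist P (g, h) (g', h') = ereal (real n)"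
    using assms by (intro P.gdist_eqI) (auto simp: pverts_P)
  also have "\<dots> = ?d"
    by (simp add: n_def one_ereal_def zero_ereal_def)
  finally show ?thesis .
qed

lemma gdist_le_4:
  assumes "u \<in> pverts P" "v \<in> pverts P"
  shows "gdist P u v \<le> 4"
  using assms by (auto simp: pverts_P gdist_direct_product)

lemma gdist_eq_0D:
  assumes "u \<in> pverts P" "v \<in> pverts P" "gdist P u v = 0"
  shows "u = v"
  using assms by (auto simp: pverts_P gdist_direct_product split: if_splits)

lemma gdist_eq_4_iff:
  assumes "u \<in> pverts P" "v \<in> pverts P"
  shows "gdist P u v = 4 \<longleftrightarrow> (u, v) \<in> parcs C"
  using assms
  by (auto simp: pverts_P cartesian_product_def gdist_direct_product one_ereal_def zero_ereal_def
      G.no_loop H.no_loop split: if_splits)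

lemma gdist_commute:
  assumes "u \<in> pverts P" "v \<in> pverts P"
  shows "gdist P u v = gdist P v u"
  using assms G.arc_commute H.arc_commute
  by (auto simp: pverts_P gdist_direct_product)

section \<open>Geodesics extend to length four\<close>

text \<open>
  The end \<open>w\<close> agrees with \<open>u\<close> in one coordinate and is a neighbour of \<open>u\<close> in the other, so that
  \<open>d(u, w) = 4\<close>. The relation of that neighbour to the corresponding coordinate of \<open>v\<close> is chosen so
  that \<open>d(v, w)\<close> makes up the difference.
\<close>
lemma geodesic_extends:
  assumes "u \<in> pverts P" "v \<in> pverts P" "u \<noteq> v"
  shows "\<exists>w \<in> pverts P. (u, w) \<in> parcs C \<and> gdist P u w = gdist P u v + gdist P v w"
proof -
  obtain g h g' h' where uv: "u = (g, h)" "v = (g', h')"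
    by (cases u; cases v)
  have V: "g \<in> pverts G" "g' \<in> pverts G" "h \<in> pverts H" "h' \<in> pverts H"
    and ne: "g \<noteq> g' \<or> h \<noteq> h'"
    using assms by (auto simp: uv pverts_P)
  have move_H: ?thesis if k: "(h, k) \<in> parcs H"
    and eq: "gdist P (g, h) (g', h') + gdist P (g', h') (g, k) = 4" for k
  proof -
    have "k \<in> pverts H"
      using k H.wellformed' by blast
    with V k have "(u, (g, k)) \<in> parcs C" "(g, k) \<in> pverts P"
      by (auto simp: uv cartesian_product_def pverts_P)
    with assms eq show ?thesis
      using gdist_eq_4_iff by (metis uv)
  qed
  have move_G: ?thesis if k: "(g, k) \<in> parcs G"
    and eq: "gdist P (g, h) (g', h') + gdist P (g', h') (k, h) = 4" for k
  proof -
    have "k \<in> pverts G"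
      using k G.wellformed' by blast
    with V k have "(u, (k, h)) \<in> parcs C" "(k, h) \<in> pverts P"
      by (auto simp: uv cartesian_product_def pverts_P)
    with assms eq show ?thesis
      using gdist_eq_4_iff by (metis uv)
  qed
  have nbr_H: "k \<in> pverts H" if "(h, k) \<in> parcs H" for k
    using that H.wellformed' by blast
  have nbr_G: "k \<in> pverts G" if "(g, k) \<in> parcs G" for k
    using that G.wellformed' by blast
  note d = gdist_direct_product V G.no_loop H.no_loop nbr_G nbr_H
  note sym = G.arc_commute[of g' g] H.arc_commute[of h' h]
  (* d(u, w) = 4 splits as 4 + 0 in the edge cases, as 1 + 3 or 2 + 2 in the far cases, where the
     neighbour k is not adjacent to the coordinate of v, and as 3 + 1 in the near cases, where it is. *)
  consider
      (edge_H) "g = g'" "(h, h') \<in> parcs H"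
    | (edge_G) "h = h'" "(g, g') \<in> parcs G"
    | (far_H) "h \<noteq> h'" "(g, g') \<in> parcs G \<longleftrightarrow> (h, h') \<in> parcs H"
    | (far_G) "h = h'" "(g, g') \<notin> parcs G"
    | (near_H) "(g, g') \<in> parcs G" "h \<noteq> h'" "(h, h') \<notin> parcs H"
    | (near_G) "(h, h') \<in> parcs H" "g \<noteq> g'" "(g, g') \<notin> parcs G"
    using ne by blast
  then show ?thesis
  proof cases
    case edge_H
    then show ?thesis by (intro move_H[of h']) (auto simp: d)
  next
    case edge_G
    then show ?thesis by (intro move_G[of g']) (auto simp: d)
  next
    case far_H
    obtain k where k: "(h, k) \<in> parcs H" "k \<noteq> h'" "(h', k) \<notin> parcs H"
      using H.neighbour_at_distance_2 V far_H by blast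
    with far_H show ?thesis by (intro move_H[of k]) (auto simp: d sym)
  next
    case far_G
    with ne have "g \<noteq> g'" by blast
    then obtain k where k: "(g, k) \<in> parcs G" "k \<noteq> g'" "(g', k) \<notin> parcs G"
      using G.neighbour_at_distance_2 V by blast
    with far_G \<open>g \<noteq> g'\<close> show ?thesis by (intro move_G[of k]) (auto simp: d sym)
  next
    case near_H
    then obtain k where k: "(h, k) \<in> parcs H" "(k, h') \<in> parcs H"
      using H.common_neighbour V by blast
    then have "(h', k) \<in> parcs H" by (simp add: H.arc_sym)
    with near_H k show ?thesis by (intro move_H[of k]) (auto simp: d sym)
  next
    case near_G
    then obtain k where k: "(g, k) \<in> parcs G" "(k, g') \<in> parcs G"
      using G.common_neighbour V by blast
    then have "(g', k) \<in> parcs G" by (simp add: G.arc_sym)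
    with near_G k show ?thesis by (intro move_G[of k]) (auto simp: d sym)
  qed
qed

section \<open>Strong metric generators are vertex covers\<close>

lemma strong_metric_generator_imp_vertex_cover:
  assumes "strong_metric_generator P S"
  shows "vertex_cover C S"
proof -
  have S: "S \<subseteq> pverts P"
    using assms by (simp add: strong_metric_generator_def)
  \<comment> \<open>Since no distance exceeds four, adding four to one leaves room only for zero.\<close>
  have far: "w = v" if "w \<in> pverts P" "v \<in> pverts P" "u \<in> pverts P"
    "gdist P w u = gdist P w v + 4" for u v w
  proof -
    have "gdist P w v + 4 \<le> 4" "0 \<le> gdist P w v"
      using that gdist_le_4[of w u] by (auto simp: pverts_P gdist_direct_product)
    then have "gdist P w v = 0"
      by (cases "gdist P w v") (auto simp: zero_ereal_def)
    then show ?thesis using that gdist_eq_0D by blast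
  qed
  have "u \<in> S \<or> v \<in> S" if uv: "(u, v) \<in> parcs C" for u v
  proof -
    have V: "u \<in> pverts P" "v \<in> pverts P"
      using uv by (auto simp: cartesian_product_def pverts_P)
    have d: "gdist P u v = 4" "gdist P v u = 4"
      using V uv gdist_eq_4_iff gdist_commute by metis+
    then have "u \<noteq> v"
      using gdist_direct_product V by (auto simp: pverts_P)
    then obtain w where w: "w \<in> S" "strongly_resolves P w u v"
      using assms V unfolding strong_metric_generator_def by blast
    then have "gdist P w u = gdist P w v + 4 \<or> gdist P w v = gdist P w u + 4"
      by (simp add: strongly_resolves_def d)
    moreover have "w \<in> pverts P"
      using S w by blast
    ultimately have "w = v \<or> w = u"
      using far[of w v u] far[of w u v] V by blast
    with w show ?thesis by blast
  qed
  then show ?thesis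
    using S by (auto simp: vertex_cover_def pverts_C)
qed

lemma vertex_cover_imp_strong_metric_generator:
  assumes "vertex_cover C S"
  shows "strong_metric_generator P S"
  unfolding strong_metric_generator_def
proof (intro conjI ballI impI)
  show S: "S \<subseteq> pverts P"
    using assms by (simp add: vertex_cover_def pverts_C)
  fix u v assume uv: "u \<in> pverts P" "v \<in> pverts P" "u \<noteq> v"
  then obtain w where w: "w \<in> pverts P" "(u, w) \<in> parcs C"
      "gdist P u w = gdist P u v + gdist P v w"
    using geodesic_extends by blast
  have "gdist P u u = 0"
    using uv by (auto simp: pverts_P gdist_direct_product)
  then have "strongly_resolves P u u v"
    by (simp add: strongly_resolves_def)
  moreover have "strongly_resolves P w u v"
    using uv w gdist_commute by (simp add: strongly_resolves_def add.commute)
  moreover have "u \<in> S \<or> w \<in> S"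
    using assms w by (auto simp: vertex_cover_def)
  ultimately show "\<exists>w \<in> S. strongly_resolves P w u v"
    by blast
qed

end

theorem theorem14:
  fixes G :: "'a pair_pre_digraph" and H :: "'b pair_pre_digraph"
  assumes "pair_graph G" and "pair_graph H"
    and "\<not> bipartite G" and "\<not> bipartite H"
    and "triangle_free G" and "triangle_free H"
    and "C5_connected G" and "C5_connected H"
    and "diam G = 2" and "diam H = 2"
  shows "strong_metric_dim (direct_product G H) = vertex_cover_number (cartesian_product G H)"
proof -
  have "parcs G \<noteq> {}" "parcs H \<noteq> {}"
    using assms(3,4) unfolding bipartite_def by blast+
  with assms interpret C5_graph_pair G H
    by (intro C5_graph_pair.intro C5_graph.intro C5_graph_axioms.intro)
  have "strong_metric_generator P S \<longleftrightarrow> vertex_cover C S" for S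
    using strong_metric_generator_imp_vertex_cover vertex_cover_imp_strong_metric_generator
    by blast
  then show ?thesis
    by (simp add: strong_metric_dim_def vertex_cover_number_def)
qed

end
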